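(* Let $f:\mathbb{R}\to\mathbb{R}$ be continuous with $\lim_{|x|\to\infty} f(x)/x=0$, let $k=(k(n))_{n\ge 0}$ be a real sequence with $\sum_{j=0}^\infty |k(j)|<+\infty$, let $(H(n))_{n\ge 1}$ be a real sequence, let $\xi\in\mathbb{R}$, and let $(x(n))_{n\ge 0}$ be the real sequence defined by $x(0)=\xi$ and $$x(n+1)=H(n+1)+\sum_{j=0}^n k(n-j)f(x(j)),\quad n\ge 0.$$ Let $H^*(n)=\max_{1\le j\le n}|H(j)|$ and $x^*(n)=\max_{0\le j\le n}|x(j)|$. Suppose that $(a(n))_{n\ge 1}$ is an increasing sequence with $a(n)\to\infty$ as $n\to\infty$. Then for each $\rho\in[0,\infty]$ the following are equivalent: (a) $\limsup_{n\to\infty}|H(n)|/a(n)=\rho$; (b) $\limsup_{n\to\infty}H^*(n)/a(n)=\rho$; (c) $\limsup_{n\to\infty}|x(n)|/a(n)=\rho$; (d) $\limsup_{n\to\infty}x^*(n)/a(n)=\rho$. *)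

theory Defs
  imports Complex_Main "HOL-Library.Extended_Real"
begin

end

theory Submission
  imports Defs
begin

text \<open>
  The four limits superior are equal, whatever their common value. Up to an arbitrarily small loss in
  the constant, each of the four sequences is eventually bounded by a multiple of \<open>a\<close> as soon as any
  other one is, and comparing such constants is the same as comparing limits superior
  (\<open>limsup_ratio_le\<close>).

  A bound \<open>\<bar>u n\<bar> \<le> c * a n\<close> passes to running maxima because \<open>a\<close> is nondecreasing, which handles the late
  indices, and unbounded, which absorbs the finitely many early ones
  (\<open>running_max_eventually_le\<close>, \<open>limsup_running_max\<close>).

  A bound passes between \<open>x\<close> and \<open>H\<close> because the convolution is a small perturbation: a
  sublinear continuous \<open>f\<close> satisfies \<open>\<bar>f y\<bar> \<le> M + \<epsilon> * \<bar>y\<bar>\<close> with \<open>\<epsilon>\<close> as small as desired, so the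
  summability of \<open>k\<close> gives \<open>\<bar>x (n + 1) - H (n + 1)\<bar> \<le> C + \<delta> * x\<^sup>* n\<close> with \<open>\<delta>\<close> as small as desired
  (\<open>convolution_small\<close>), where \<open>x\<^sup>*\<close> is the running maximum of \<open>\<bar>x\<bar>\<close>. The constant \<open>C\<close> is
  negligible against \<open>a\<close>. Bounding \<open>H\<close> by \<open>x\<close> is then immediate; to bound \<open>x\<close> by \<open>H\<close>, the term
  \<open>\<delta> * x\<^sup>* n\<close> is moved to the left-hand side, which costs the factor \<open>1 / (1 - \<delta>)\<close>.
\<close>

section \<open>Growth relative to a monotone divergent sequence\<close>

text \<open>
  Two constants \<open>c < d\<close> are allowed in the hypothesis so that every transfer of a bound may lose an
  arbitrarily small factor. Only positive \<open>c\<close> occur: a nonpositive number cannot exceed the limit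
  superior of an eventually nonnegative sequence.
\<close>

lemma limsup_ratio_le:
  fixes u v a :: "nat \<Rightarrow> real"
  assumes a_lim: "filterlim a at_top sequentially"
    and u_nonneg: "eventually (\<lambda>n. 0 \<le> u n) sequentially"
    and transfer: "\<And>c d. 0 < c \<Longrightarrow> c < d \<Longrightarrow> eventually (\<lambda>n. u n \<le> c * a n) sequentially
      \<Longrightarrow> eventually (\<lambda>n. v n \<le> d * a n) sequentially"
  shows "limsup (\<lambda>n. ereal (v n / a n)) \<le> limsup (\<lambda>n. ereal (u n / a n))"
proof (rule ccontr)
  assume "\<not> ?thesis"
  then have "limsup (\<lambda>n. ereal (u n / a n)) < limsup (\<lambda>n. ereal (v n / a n))" by simp
  then obtain d where d: "limsup (\<lambda>n. ereal (u n / a n)) < ereal d"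
      "ereal d < limsup (\<lambda>n. ereal (v n / a n))"
    using ereal_dense2 by blast
  obtain c where c: "limsup (\<lambda>n. ereal (u n / a n)) < ereal c" "ereal c < ereal d"
    using ereal_dense2[OF d(1)] by blast
  have a_pos: "eventually (\<lambda>n. 0 < a n) sequentially"
    using a_lim by (simp add: filterlim_at_top_dense)
  have u_less: "eventually (\<lambda>n. u n / a n < c) sequentially"
    using Limsup_lessD[OF c(1)] by simp
  have "eventually (\<lambda>n. 0 < c) sequentially"
    using u_less a_pos u_nonneg
    by eventually_elim (meson divide_nonneg_pos le_less_trans)
  then have "0 < c" by simp
  moreover have "eventually (\<lambda>n. u n \<le> c * a n) sequentially"
    using u_less a_pos by eventually_elim (simp add: pos_divide_less_eq)
  ultimately have "eventually (\<lambda>n. v n \<le> d * a n) sequentially"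
    using transfer c(2) by simp
  then have "eventually (\<lambda>n. ereal (v n / a n) \<le> ereal d) sequentially"
    using a_pos by eventually_elim (simp add: pos_divide_le_eq)
  then have "limsup (\<lambda>n. ereal (v n / a n)) \<le> ereal d"
    by (rule Limsup_bounded)
  with d(2) show False by simp
qed

text \<open>
  Any constant is eventually below \<open>c * a n\<close>, so the early values of \<open>u\<close> do no harm; the late ones
  are bounded by \<open>c * a j \<le> c * a n\<close>.
\<close>

lemma running_max_eventually_le:
  fixes u a :: "nat \<Rightarrow> real"
  assumes a_mono: "mono_on {1..} a"
    and a_lim: "filterlim a at_top sequentially"
    and c: "0 < c"
    and u: "eventually (\<lambda>n. \<bar>u n\<bar> \<le> c * a n) sequentially"
  shows "eventually (\<lambda>n. (MAX j\<in>{m..n}. \<bar>u j\<bar>) \<le> c * a n) sequentially"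
proof -
  obtain N where N: "\<And>n. N \<le> n \<Longrightarrow> \<bar>u n\<bar> \<le> c * a n"
    using u by (auto simp: eventually_sequentially)
  define B where "B = (\<Sum>j\<le>N. \<bar>u j\<bar>)"
  have B: "\<bar>u j\<bar> \<le> B" if "j \<le> N" for j
    unfolding B_def using that by (intro member_le_sum) auto
  have "eventually (\<lambda>n. B / c \<le> a n) sequentially"
    using a_lim by (simp add: filterlim_at_top)
  then show ?thesis
    using eventually_ge_at_top[of m]
  proof eventually_elim
    case (elim n)
    have "\<bar>u j\<bar> \<le> c * a n" if "j \<le> n" for j
    proof (cases "j \<le> N")
      case True
      then show ?thesis using B[OF True] elim(1) c by (simp add: field_simps)
    next
      case False
      then have "a j \<le> a n" using that by (intro mono_onD[OF a_mono]) auto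
      then have "c * a j \<le> c * a n" using c by simp
      with N[of j] False show ?thesis by simp
    qed
    with elim(2) show ?case by simp
  qed
qed

lemma limsup_running_max:
  fixes u a :: "nat \<Rightarrow> real"
  assumes a_mono: "mono_on {1..} a"
    and a_lim: "filterlim a at_top sequentially"
  shows "limsup (\<lambda>n. ereal ((MAX j\<in>{m..n}. \<bar>u j\<bar>) / a n)) = limsup (\<lambda>n. ereal (\<bar>u n\<bar> / a n))"
proof (rule antisym)
  have a_pos: "eventually (\<lambda>n. 0 < a n) sequentially"
    using a_lim by (simp add: filterlim_at_top_dense)
  show "limsup (\<lambda>n. ereal ((MAX j\<in>{m..n}. \<bar>u j\<bar>) / a n)) \<le> limsup (\<lambda>n. ereal (\<bar>u n\<bar> / a n))"
  proof (rule limsup_ratio_le[OF a_lim])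
    fix c d :: real
    assume cd: "0 < c" "c < d" and "eventually (\<lambda>n. \<bar>u n\<bar> \<le> c * a n) sequentially"
    then have "eventually (\<lambda>n. (MAX j\<in>{m..n}. \<bar>u j\<bar>) \<le> c * a n) sequentially"
      by (intro running_max_eventually_le[OF a_mono a_lim])
    then show "eventually (\<lambda>n. (MAX j\<in>{m..n}. \<bar>u j\<bar>) \<le> d * a n) sequentially"
      using a_pos
    proof eventually_elim
      case (elim n)
      have "c * a n \<le> d * a n" using cd elim(2) by simp
      with elim(1) show ?case by linarith
    qed
  qed simp
  have "eventually (\<lambda>n. ereal (\<bar>u n\<bar> / a n) \<le> ereal ((MAX j\<in>{m..n}. \<bar>u j\<bar>) / a n)) sequentially"
    using a_pos eventually_ge_at_top[of m]
    by eventually_elim (auto intro!: divide_right_mono Max_ge)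
  then show "limsup (\<lambda>n. ereal (\<bar>u n\<bar> / a n)) \<le> limsup (\<lambda>n. ereal ((MAX j\<in>{m..n}. \<bar>u j\<bar>) / a n))"
    by (rule Limsup_mono)
qed

section \<open>The convolution as a small perturbation\<close>

text \<open>
  Far from the origin the term \<open>\<epsilon> * \<bar>y\<bar>\<close> alone suffices; \<open>M\<close> is a bound for \<open>f\<close> on the remaining
  compact interval.
\<close>

lemma sublinear_bound:
  fixes f :: "real \<Rightarrow> real"
  assumes f_cont: "continuous_on UNIV f"
    and f_sublinear: "((\<lambda>y. f y / y) \<longlongrightarrow> 0) at_infinity"
    and \<epsilon>: "0 < \<epsilon>"
  obtains M where "0 \<le> M" "\<And>y. \<bar>f y\<bar> \<le> M + \<epsilon> * \<bar>y\<bar>"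
proof -
  have "eventually (\<lambda>y. \<bar>f y / y\<bar> < \<epsilon>) at_infinity"
    using tendstoD[OF f_sublinear \<epsilon>] by (simp add: dist_real_def)
  then obtain b where b: "\<And>y. b \<le> \<bar>y\<bar> \<Longrightarrow> \<bar>f y / y\<bar> < \<epsilon>"
    by (auto simp: eventually_at_infinity)
  define R where "R = \<bar>b\<bar> + 1"
  have "\<forall>y. - R \<le> y \<and> y \<le> R \<longrightarrow> isCont (\<lambda>y. \<bar>f y\<bar>) y"
    using f_cont by (auto simp: continuous_on_eq_continuous_at intro!: continuous_intros)
  then obtain M where M: "\<And>y. - R \<le> y \<Longrightarrow> y \<le> R \<Longrightarrow> \<bar>f y\<bar> \<le> M"
    using isCont_bounded[of "- R" R "\<lambda>y. \<bar>f y\<bar>"] by (auto simp: R_def)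
  have "\<bar>f 0\<bar> \<le> M" by (rule M) (simp_all add: R_def)
  then have "0 \<le> M" by linarith
  moreover have "\<bar>f y\<bar> \<le> M + \<epsilon> * \<bar>y\<bar>" for y
  proof (cases "\<bar>y\<bar> \<le> R")
    case True
    then have "\<bar>f y\<bar> \<le> M" using M[of y] by (simp add: abs_le_iff)
    with \<epsilon> show ?thesis by (simp add: add_increasing2)
  next
    case False
    then have "0 < \<bar>y\<bar>" "\<bar>f y / y\<bar> < \<epsilon>" using b[of y] by (auto simp: R_def)
    then have "\<bar>f y\<bar> < \<epsilon> * \<bar>y\<bar>" by (simp add: pos_divide_less_eq)
    with \<open>0 \<le> M\<close> show ?thesis by simp
  qed
  ultimately show thesis by (rule that)
qed

lemma convolution_small:
  fixes f :: "real \<Rightarrow> real" and k x :: "nat \<Rightarrow> real"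
  assumes f_cont: "continuous_on UNIV f"
    and f_sublinear: "((\<lambda>y. f y / y) \<longlongrightarrow> 0) at_infinity"
    and k_summable: "summable (\<lambda>j. \<bar>k j\<bar>)"
    and \<delta>: "0 < \<delta>"
  obtains C where "0 \<le> C"
    "\<And>n. \<bar>\<Sum>j=0..n. k (n - j) * f (x j)\<bar> \<le> C + \<delta> * (MAX j\<in>{0..n}. \<bar>x j\<bar>)"
proof -
  \<comment> \<open>The \<open>+ 1\<close> keeps the divisor below positive when \<open>k\<close> vanishes identically.\<close>
  define K where "K = (\<Sum>j. \<bar>k j\<bar>) + 1"
  have K: "0 < K" using suminf_nonneg[OF k_summable] by (simp add: K_def)
  obtain M where M: "0 \<le> M" "\<And>y. \<bar>f y\<bar> \<le> M + \<delta> / K * \<bar>y\<bar>"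
    using sublinear_bound[OF f_cont f_sublinear, of "\<delta> / K"] \<delta> K by auto
  have "\<bar>\<Sum>j=0..n. k (n - j) * f (x j)\<bar> \<le> K * M + \<delta> * (MAX j\<in>{0..n}. \<bar>x j\<bar>)" for n
  proof -
    define X where "X = (MAX j\<in>{0..n}. \<bar>x j\<bar>)"
    have X: "\<bar>x j\<bar> \<le> X" if "j \<le> n" for j
      unfolding X_def using that by (intro Max_ge) auto
    have "0 \<le> X" using X[of 0] by simp
    define L where "L = M + \<delta> / K * X"
    have "0 \<le> L" using M(1) \<delta> K \<open>0 \<le> X\<close> by (simp add: L_def)
    have f_le: "\<bar>f (x j)\<bar> \<le> L" if "j \<le> n" for j
    proof -
      have "\<delta> / K * \<bar>x j\<bar> \<le> \<delta> / K * X" using X[OF that] \<delta> K by (intro mult_left_mono) auto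
      with M(2)[of "x j"] show ?thesis by (simp add: L_def)
    qed
    have "\<bar>\<Sum>j=0..n. k (n - j) * f (x j)\<bar> \<le> (\<Sum>j=0..n. \<bar>k (n - j) * f (x j)\<bar>)"
      by (rule sum_abs)
    also have "\<dots> \<le> (\<Sum>j=0..n. \<bar>k (n - j)\<bar> * L)"
      using f_le by (intro sum_mono) (auto simp: abs_mult intro!: mult_left_mono)
    also have "\<dots> = (\<Sum>j=0..n. \<bar>k (n - j)\<bar>) * L"
      by (simp add: sum_distrib_right)
    also have "(\<Sum>j=0..n. \<bar>k (n - j)\<bar>) = (\<Sum>j\<le>n. \<bar>k j\<bar>)"
      by (rule sum.reindex_bij_witness[of _ "\<lambda>j. n - j" "\<lambda>j. n - j"]) auto
    also have "(\<Sum>j\<le>n. \<bar>k j\<bar>) * L \<le> K * L"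
    proof (rule mult_right_mono[OF _ \<open>0 \<le> L\<close>])
      have "(\<Sum>j\<le>n. \<bar>k j\<bar>) \<le> (\<Sum>j. \<bar>k j\<bar>)"
        by (rule sum_le_suminf[OF k_summable]) auto
      then show "(\<Sum>j\<le>n. \<bar>k j\<bar>) \<le> K" by (simp add: K_def)
    qed
    also have "K * L = K * M + \<delta> * X"
      using K by (simp add: L_def field_simps)
    finally show ?thesis by (simp add: X_def)
  qed
  moreover have "0 \<le> K * M" using K M(1) by simp
  ultimately show thesis using that by blast
qed

text \<open>
  The running maximum \<open>X\<close> of \<open>\<bar>x\<bar>\<close> satisfies \<open>X \<le> \<bar>x 0\<bar> + C + H\<^sup>* + \<delta> * X\<close>, where \<open>H\<^sup>*\<close> is the
  running maximum of \<open>\<bar>H\<bar>\<close>; the summand \<open>\<bar>x 0\<bar>\<close> is there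
  because the recursion says nothing about the index \<open>0\<close>. Choosing \<open>\<delta>\<close> with
  \<open>c < d * (1 - \<delta>)\<close> leaves room to absorb the constants.
\<close>

lemma solution_eventually_le:
  fixes H x a :: "nat \<Rightarrow> real"
  assumes perturbation: "\<And>\<delta>::real. 0 < \<delta> \<Longrightarrow>
      \<exists>C\<ge>0. \<forall>n. \<bar>x (n + 1) - H (n + 1)\<bar> \<le> C + \<delta> * (MAX j\<in>{0..n}. \<bar>x j\<bar>)"
    and a_mono: "mono_on {1..} a"
    and a_lim: "filterlim a at_top sequentially"
    and cd: "0 < c" "c < d"
    and H: "eventually (\<lambda>n. \<bar>H n\<bar> \<le> c * a n) sequentially"
  shows "eventually (\<lambda>n. \<bar>x n\<bar> \<le> d * a n) sequentially"
proof -
  define \<delta> where "\<delta> = (d - c) / (2 * d)"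
  have \<delta>: "0 < \<delta>" "\<delta> < 1" "d * (1 - \<delta>) = (c + d) / 2"
    using cd by (auto simp: \<delta>_def field_simps)
  obtain C where C: "0 \<le> C"
      "\<And>n. \<bar>x (n + 1) - H (n + 1)\<bar> \<le> C + \<delta> * (MAX j\<in>{0..n}. \<bar>x j\<bar>)"
    using perturbation[OF \<delta>(1)] by blast
  have "eventually (\<lambda>n. 2 * (\<bar>x 0\<bar> + C) / (d - c) \<le> a n) sequentially"
    using a_lim by (simp add: filterlim_at_top)
  then show ?thesis
    using running_max_eventually_le[OF a_mono a_lim cd(1) H, of 1] eventually_ge_at_top[of 1]
  proof eventually_elim
    case (elim n)
    define X where "X = (MAX j\<in>{0..n}. \<bar>x j\<bar>)"
    have le_X: "\<bar>x j\<bar> \<le> X" if "j \<le> n" for j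
      unfolding X_def using that by (intro Max_ge) auto
    have "\<bar>x j\<bar> \<le> \<bar>x 0\<bar> + C + c * a n + \<delta> * X" if "j \<le> n" for j
    proof (cases j)
      case 0
      have "\<bar>H n\<bar> \<le> c * a n"
        using elim(3) by (intro order_trans[OF Max_ge elim(2)]) auto
      moreover have "0 \<le> \<delta> * X" using le_X[of 0] \<delta>(1) by simp
      ultimately show ?thesis using 0 C(1) by simp
    next
      case (Suc i)
      have "(MAX j\<in>{0..i}. \<bar>x j\<bar>) \<le> X"
        unfolding X_def using that Suc by (intro Max_mono) auto
      then have "\<delta> * (MAX j\<in>{0..i}. \<bar>x j\<bar>) \<le> \<delta> * X" using \<delta>(1) by simp
      moreover have "\<bar>H j\<bar> \<le> c * a n"
        using that Suc by (intro order_trans[OF Max_ge elim(2)]) auto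
      ultimately show ?thesis using C(2)[of i] Suc by simp
    qed
    then have "X \<le> \<bar>x 0\<bar> + C + c * a n + \<delta> * X"
      by (simp add: X_def)
    moreover have "\<bar>x 0\<bar> + C \<le> (d - c) / 2 * a n"
      using elim(1) cd by (simp add: field_simps)
    ultimately have "X * (1 - \<delta>) \<le> (c + d) / 2 * a n"
      by (simp add: field_simps)
    also have "\<dots> = (d * a n) * (1 - \<delta>)"
      unfolding \<delta>(3)[symmetric] by simp
    finally have "X \<le> d * a n" using \<delta>(2) by simp
    then show ?case using le_X[of n] by simp
  qed
qed

text \<open>
  Here \<open>x\<close> is already known to be of size \<open>c * a n\<close>, so the perturbation is at most
  \<open>C + \<delta> * c * a n\<close>; each of its two terms may use up half of the gap between \<open>c\<close> and \<open>d\<close>.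
\<close>

lemma forcing_eventually_le:
  fixes H x a :: "nat \<Rightarrow> real"
  assumes perturbation: "\<And>\<delta>::real. 0 < \<delta> \<Longrightarrow>
      \<exists>C\<ge>0. \<forall>n. \<bar>x (n + 1) - H (n + 1)\<bar> \<le> C + \<delta> * (MAX j\<in>{0..n}. \<bar>x j\<bar>)"
    and a_mono: "mono_on {1..} a"
    and a_lim: "filterlim a at_top sequentially"
    and cd: "0 < c" "c < d"
    and x: "eventually (\<lambda>n. \<bar>x n\<bar> \<le> c * a n) sequentially"
  shows "eventually (\<lambda>n. \<bar>H n\<bar> \<le> d * a n) sequentially"
proof -
  define \<delta> where "\<delta> = (d - c) / (2 * c)"
  have \<delta>: "0 < \<delta>" "\<delta> * c = (d - c) / 2"
    using cd by (auto simp: \<delta>_def)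
  obtain C where C: "0 \<le> C"
      "\<And>n. \<bar>x (n + 1) - H (n + 1)\<bar> \<le> C + \<delta> * (MAX j\<in>{0..n}. \<bar>x j\<bar>)"
    using perturbation[OF \<delta>(1)] by blast
  have "eventually (\<lambda>n. 2 * C / (d - c) \<le> a n) sequentially"
    using a_lim by (simp add: filterlim_at_top)
  then show ?thesis
    using running_max_eventually_le[OF a_mono a_lim cd(1) x, of 0] eventually_ge_at_top[of 1]
  proof eventually_elim
    case (elim n)
    then obtain i where i: "n = Suc i" by (cases n) auto
    have "(MAX j\<in>{0..i}. \<bar>x j\<bar>) \<le> (MAX j\<in>{0..n}. \<bar>x j\<bar>)"
      unfolding i by (intro Max_mono) auto
    with elim(2) have "(MAX j\<in>{0..i}. \<bar>x j\<bar>) \<le> c * a n" by linarith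
    then have "\<delta> * (MAX j\<in>{0..i}. \<bar>x j\<bar>) \<le> \<delta> * (c * a n)" using \<delta>(1) by simp
    also have "\<dots> = (d - c) / 2 * a n" by (simp only: \<delta>(2)[symmetric] mult.assoc)
    finally have "\<delta> * (MAX j\<in>{0..i}. \<bar>x j\<bar>) \<le> (d - c) / 2 * a n" .
    moreover have "C \<le> (d - c) / 2 * a n"
      using elim(1) cd by (simp add: field_simps)
    moreover have "\<bar>x n\<bar> \<le> c * a n"
      by (intro order_trans[OF Max_ge elim(2)]) auto
    moreover have "(d - c) / 2 * a n + (d - c) / 2 * a n + c * a n = d * a n"
      by (simp add: field_simps)
    ultimately show ?case using C(2)[of i] i by simp
  qed
qed

section \<open>Equality of the growth rates\<close>

theorem theorem10:
  fixes f :: "real \<Rightarrow> real"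
    and k H x a :: "nat \<Rightarrow> real"
    and \<xi> :: real
    and \<rho> :: ereal
  assumes f_cont: "continuous_on UNIV f"
    and f_sublinear: "((\<lambda>y. f y / y) \<longlongrightarrow> 0) at_infinity"
    and k_summable: "summable (\<lambda>j. \<bar>k j\<bar>)"
    and x_init: "x 0 = \<xi>"
    and x_rec: "\<And>n. x (n + 1) = H (n + 1) + (\<Sum>j=0..n. k (n - j) * f (x j))"
    and a_mono: "mono_on {1..} a"
    and a_lim: "filterlim a at_top sequentially"
    and \<rho>_nonneg: "0 \<le> \<rho>"
  shows
    "(limsup (\<lambda>n. ereal (\<bar>H n\<bar> / a n)) = \<rho>
        \<longleftrightarrow> limsup (\<lambda>n. ereal ((MAX j\<in>{1..n}. \<bar>H j\<bar>) / a n)) = \<rho>) \<and>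
     (limsup (\<lambda>n. ereal ((MAX j\<in>{1..n}. \<bar>H j\<bar>) / a n)) = \<rho>
        \<longleftrightarrow> limsup (\<lambda>n. ereal (\<bar>x n\<bar> / a n)) = \<rho>) \<and>
     (limsup (\<lambda>n. ereal (\<bar>x n\<bar> / a n)) = \<rho>
        \<longleftrightarrow> limsup (\<lambda>n. ereal ((MAX j\<in>{0..n}. \<bar>x j\<bar>) / a n)) = \<rho>)"
proof -
  have perturbation: "\<exists>C\<ge>0. \<forall>n. \<bar>x (n + 1) - H (n + 1)\<bar> \<le> C + \<delta> * (MAX j\<in>{0..n}. \<bar>x j\<bar>)"
    if \<delta>: "0 < \<delta>" for \<delta> :: real
  proof -
    obtain C where "0 \<le> C"
      "\<And>n. \<bar>\<Sum>j=0..n. k (n - j) * f (x j)\<bar> \<le> C + \<delta> * (MAX j\<in>{0..n}. \<bar>x j\<bar>)"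
      using convolution_small[OF f_cont f_sublinear k_summable \<delta>] by blast
    moreover have "x (n + 1) - H (n + 1) = (\<Sum>j=0..n. k (n - j) * f (x j))" for n
      using x_rec[of n] by linarith
    ultimately show ?thesis by auto
  qed
  have "limsup (\<lambda>n. ereal (\<bar>x n\<bar> / a n)) = limsup (\<lambda>n. ereal (\<bar>H n\<bar> / a n))"
  proof (rule antisym)
    show "limsup (\<lambda>n. ereal (\<bar>x n\<bar> / a n)) \<le> limsup (\<lambda>n. ereal (\<bar>H n\<bar> / a n))"
      using solution_eventually_le[OF perturbation a_mono a_lim]
      by (intro limsup_ratio_le[OF a_lim]) auto
    show "limsup (\<lambda>n. ereal (\<bar>H n\<bar> / a n)) \<le> limsup (\<lambda>n. ereal (\<bar>x n\<bar> / a n))"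
      using forcing_eventually_le[OF perturbation a_mono a_lim]
      by (intro limsup_ratio_le[OF a_lim]) auto
  qed
  then show ?thesis
    by (simp only: limsup_running_max[OF a_mono a_lim])
qed

end
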